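(* Let $n\ge3$ be a prime power and let $T_k$ ($1\le k\le n^2-1$) be the sets of functions $y^iz^j/x^k$ on the GK curve defined as follows: for $1\le k\le n-1$, the index pairs are $0\le i\le k,\ k-i+1\le j\le n^2-n$ together with $k+1\le i\le n,\ 0\le j\le n^2-n$; for $n\le k\le n^2-n-2$, the index pairs are $0\le i\le n,\ k-i+1\le j\le n^2-n$; for $n^2-n-1\le k\le n^2-1$, the index pairs are $k-n^2+n+1\le i\le n,\ k-i+1\le j\le n^2-n$. If $f\in T_k$ and $f'\in T_{k'}$ (with $k,k'$ not necessarily distinct) and $f\ne f'$, then their divisors of poles differ: $(f)_\infty\neq(f')_\infty$.
   Context: Let $n\ge 2$ be a prime power and $q=n^3$. The GK curve is the nonsingular curve over $\mathbb{F}_{q^2}$ with affine equations $Z^{n^2-n+1}=Y\,h(X)$, $X^n+X=Y^{n+1}$, where $h(X)=\sum_{i=0}^{n}(-1)^{i+1}X^{i(n-1)}$; its function field is $\mathbb{F}_{q^2}(x,y,z)$ with $z^{n^2-n+1}=y h(x)$, $x^n+x=y^{n+1}$. $P_\infty=(1:0:0:0)$ is its unique point at infinity and $P_0=(0,0,0)$. For a rational function $f$, $(f)_\infty$ denotes its divisor of poles. *)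

theory Defs
  imports "HOL-Computational_Algebra.Computational_Algebra"
begin

definition field_emb :: "('k::field \<Rightarrow> 'L::field) \<Rightarrow> bool" where
  "field_emb e \<longleftrightarrow> inj e \<and> e 0 = 0 \<and> e 1 = 1 \<and>
     (\<forall>a b. e (a + b) = e a + e b) \<and> (\<forall>a b. e (a * b) = e a * e b)"

definition is_subfield :: "('L::field) set \<Rightarrow> bool" where
  "is_subfield S \<longleftrightarrow> 0 \<in> S \<and> 1 \<in> S \<and>
     (\<forall>a\<in>S. \<forall>b\<in>S. a + b \<in> S \<and> a - b \<in> S \<and> a * b \<in> S) \<and>
     (\<forall>a\<in>S. inverse a \<in> S)"

definition gk_h :: "nat \<Rightarrow> 'L::field \<Rightarrow> 'L" where
  "gk_h n X = (\<Sum>i\<le>n. (-1) ^ (i + 1) * X ^ (i * (n - 1)))"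

text \<open>L is (a copy of) the GK function field F_{q^2}(x,y,z), q = n^3, over the
  constant field e('k): x is transcendental over the constants, L is generated
  by x,y,z over the constants, and the defining equations hold.\<close>
definition GK_function_field ::
  "nat \<Rightarrow> ('k::field \<Rightarrow> 'L::field) \<Rightarrow> 'L \<Rightarrow> 'L \<Rightarrow> 'L \<Rightarrow> bool" where
  "GK_function_field n e x y z \<longleftrightarrow>
     field_emb e \<and>
     (\<forall>p::'k poly. p \<noteq> 0 \<longrightarrow> poly (map_poly e p) x \<noteq> 0) \<and>
     (\<forall>S. is_subfield S \<and> range e \<subseteq> S \<and> x \<in> S \<and> y \<in> S \<and> z \<in> S \<longrightarrow> S = UNIV) \<and>
     z ^ (n^2 - n + 1) = y * gk_h n x \<and>
     x ^ n + x = y ^ (n + 1)"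

text \<open>Places of L/e('k), represented by their normalized discrete valuations
  (values on nonzero elements; trivial on nonzero constants; surjective onto Z,
  which follows from having an element of value 1).\<close>
definition is_place :: "('k::field \<Rightarrow> 'L::field) \<Rightarrow> ('L \<Rightarrow> int) \<Rightarrow> bool" where
  "is_place e v \<longleftrightarrow>
     (\<forall>a b. a \<noteq> 0 \<longrightarrow> b \<noteq> 0 \<longrightarrow> v (a * b) = v a + v b) \<and>
     (\<forall>a b. a \<noteq> 0 \<longrightarrow> b \<noteq> 0 \<longrightarrow> a + b \<noteq> 0 \<longrightarrow> min (v a) (v b) \<le> v (a + b)) \<and>
     (\<forall>c. c \<noteq> 0 \<longrightarrow> v (e c) = 0) \<and>
     (\<exists>t. t \<noteq> 0 \<and> v t = 1)"

definition pole_divisor :: "('k::field \<Rightarrow> 'L::field) \<Rightarrow> 'L \<Rightarrow> ('L \<Rightarrow> int) \<Rightarrow> nat" where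
  "pole_divisor e f = (\<lambda>v. if is_place e v then nat (- v f) else 0)"

definition T_idx :: "nat \<Rightarrow> nat \<Rightarrow> (nat \<times> nat) set" where
  "T_idx n k =
     (if 1 \<le> k \<and> k \<le> n - 1 then
        {(i, j). i \<le> k \<and> k + 1 \<le> i + j \<and> j \<le> n^2 - n} \<union>
        {(i, j). k + 1 \<le> i \<and> i \<le> n \<and> j \<le> n^2 - n}
      else if n \<le> k \<and> k + 2 \<le> n^2 - n then
        {(i, j). i \<le> n \<and> k + 1 \<le> i + j \<and> j \<le> n^2 - n}
      else if n^2 - n \<le> k + 1 \<and> k \<le> n^2 - 1 then
        {(i, j). k + n + 1 \<le> i + n^2 \<and> i \<le> n \<and> k + 1 \<le> i + j \<and> j \<le> n^2 - n}
      else {})"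

definition T_set :: "nat \<Rightarrow> 'L::field \<Rightarrow> 'L \<Rightarrow> 'L \<Rightarrow> nat \<Rightarrow> 'L set" where
  "T_set n x y z k = (\<lambda>(i, j). y ^ i * z ^ j / x ^ k) ` T_idx n k"

end

theory Submission
  imports Defs "Jordan_Normal_Form.Char_Poly" "HOL-Number_Theory.Residues"
begin

text \<open>
  Write m = n^2 - n + 1, so that n^3 + 1 = (n+1) m. At the point P_0 = (0,0,0) the functions
  x, y, z have valuations (n+1) m, m and 1, hence y^i z^j / x^k has a pole of order
  k (n+1) m - i m - j > 0 there; as i \<le> n and j < m, this mixed-radix expansion determines
  (i, j, k).

  The valuation at P_0 comes from an embedding of the function field into Laurent series
  F((t)) with x \<mapsto> t^((n+1) m), y \<mapsto> t^m U, z \<mapsto> t V, where the power series units U, V solve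
  U^(n+1) = 1 + t^((n+1) m (n-1)) and V^m = U h(t^((n+1) m)); they exist because n + 1 and m
  are prime to the characteristic. Every element of the function field is an F(x)-combination
  of the (n+1) m monomials y^(l div m) z^(l mod m), and the images of these monomials have
  orders l, pairwise incongruent modulo (n+1) m. So a nonzero combination maps to a nonzero
  Laurent series; the determinant of its multiplication matrix is therefore nonzero, which
  makes the combination invertible, in particular nonzero, in the function field. Thus the
  representation is unique and the embedding is well defined.
\<close>

section \<open>Roots of power series in positive characteristic\<close>

text \<open>The library proves this for \<open>field_char_0\<close> (see \<open>power_radical\<close>); the argument only
  divides by \<open>k + 1\<close>.\<close>
lemma fps_radical_power_nth_pos:
  fixes a:: "'a::field fps"
  assumes a0: "a$0 \<noteq> 0" and kn: "(of_nat (Suc k) :: 'a) \<noteq> 0"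
    and r0: "(r (Suc k) (a$0)) ^ Suc k = a$0" and n: "0 < n"
  shows "fps_radical r (Suc k) a ^ Suc k $ n = a $ n"
proof -
  let ?r = "fps_radical r (Suc k) a"
  from a0 r0 have r00: "r (Suc k) (a$0) \<noteq> 0" by auto
  obtain n1 where Suc: "n = Suc n1" using n by (cases n) auto
  have "n \<noteq> 0" using n by simp
  let ?Pnk = "natpermute n (k + 1)"
  let ?Pnkn = "{xs \<in> ?Pnk. n \<in> set xs}"
  let ?Pnknn = "{xs \<in> ?Pnk. n \<notin> set xs}"
  have eq: "?Pnkn \<union> ?Pnknn = ?Pnk" by blast
  have d: "?Pnkn \<inter> ?Pnknn = {}" by blast
  have f: "finite ?Pnkn" "finite ?Pnknn"
    using finite_Un[of ?Pnkn ?Pnknn, unfolded eq]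
    by (metis natpermute_finite)+
  let ?f = "\<lambda>v. \<Prod>j\<in>{0..k}. ?r $ v ! j"
  have "sum ?f ?Pnkn = sum (\<lambda>v. ?r $ n * r (Suc k) (a $ 0) ^ k) ?Pnkn"
  proof (rule sum.cong)
    fix v assume v: "v \<in> {xs \<in> natpermute n (k + 1). n \<in> set xs}"
    from v obtain i where i: "i \<in> {0..k}" "v = (replicate (k+1) 0) [i:= n]"
      unfolding natpermute_contain_maximal by auto
    have "(\<Prod>j\<in>{0..k}. ?r $ v ! j) = (\<Prod>j\<in>{0..k}. if j = i then ?r $ n else r (Suc k) (a$0))"
      using i r0 by (auto simp del: replicate.simps intro: prod.cong)
    also have "\<dots> = ?r $ n * r (Suc k) (a$0) ^ k"
      using i r0 by (simp add: prod_gen_delta)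
    finally show "(\<Prod>j\<in>{0..k}. ?r $ v ! j) = ?r $ n * r (Suc k) (a $ 0) ^ k" .
  qed rule
  then have "sum ?f ?Pnkn = of_nat (k+1) * ?r $ n * r (Suc k) (a $ 0) ^ k"
    by (simp add: natpermute_max_card[OF \<open>n \<noteq> 0\<close>, simplified])
  also have "\<dots> = a$n - sum ?f ?Pnknn"
    unfolding Suc using r00 a0 kn by (simp add: field_simps fps_radical_def del: of_nat_Suc)
  finally have fn: "sum ?f ?Pnkn = a$n - sum ?f ?Pnknn" .
  have "(?r ^ Suc k)$n = sum ?f ?Pnkn + sum ?f ?Pnknn"
    unfolding fps_power_nth_Suc sum.union_disjoint[OF f d, unfolded eq] ..
  also have "\<dots> = a$n" unfolding fn by simp
  finally show ?thesis .
qed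

lemma power_radical_of_nat_nonzero:
  fixes a:: "'a::field fps"
  assumes a0: "a$0 \<noteq> 0" and kn: "(of_nat (Suc k) :: 'a) \<noteq> 0"
    and r0: "(r (Suc k) (a$0)) ^ Suc k = a$0"
  shows "(fps_radical r (Suc k) a) ^ (Suc k) = a"
proof (rule fps_ext)
  fix n
  show "fps_radical r (Suc k) a ^ Suc k $ n = a $ n"
  proof (cases "n = 0")
    case True
    then show ?thesis using fps_radical_power_nth[of r "Suc k" a, OF r0] by simp
  qed (use fps_radical_power_nth_pos[where a = a and k = k and r = r, OF a0 kn r0] in simp)
qed

lemma fps_nth_root_exists:
  fixes a:: "'a::field fps"
  assumes "0 < k" "(of_nat k :: 'a) \<noteq> 0" "c ^ k = a $ 0" "c \<noteq> 0"
  shows "\<exists>b. b ^ k = a \<and> b $ 0 = c"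
proof -
  obtain k' where k: "k = Suc k'" using assms(1) by (cases k) auto
  let ?r = "\<lambda>_ _. c"
  have "(fps_radical ?r (Suc k') a) ^ (Suc k') = a"
    by (rule power_radical_of_nat_nonzero) (use assms k in auto)
  moreover have "fps_radical ?r (Suc k') a $ 0 = c" by simp
  ultimately show ?thesis using k by blast
qed

section \<open>The monomial basis of the GK function field over the rational functions in x\<close>

definition gk_m :: "nat \<Rightarrow> nat" where "gk_m n = n^2 - n + 1"
definition gk_deg :: "nat \<Rightarrow> nat" where "gk_deg n = (n+1) * gk_m n"

definition gk_monomial :: "nat \<Rightarrow> 'F::comm_ring_1 \<Rightarrow> 'F \<Rightarrow> nat \<Rightarrow> 'F" where
  "gk_monomial n y z l = y ^ (l div gk_m n) * z ^ (l mod gk_m n)"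

definition gk_aP :: "nat \<Rightarrow> 'k::comm_ring_1 poly" where "gk_aP n = [:0,1:]^n + [:0,1:]"
definition gk_hP :: "nat \<Rightarrow> 'k::comm_ring_1 poly" where
  "gk_hP n = (\<Sum>i\<le>n. [:(-1)^(i+1):] * [:0,1:]^(i*(n-1)))"

text \<open>Using y^(n+1) = aP(x) and z^m = y h(x), the product of the monomials with indices l and b
  is \<open>prod_coeff n l b\<close>, evaluated at x, times the monomial with index \<open>prod_index n l b\<close>.\<close>
definition prod_y_exp :: "nat \<Rightarrow> nat \<Rightarrow> nat \<Rightarrow> nat" where
  "prod_y_exp n l b = l div gk_m n + b div gk_m n + (l mod gk_m n + b mod gk_m n) div gk_m n"
definition prod_z_exp :: "nat \<Rightarrow> nat \<Rightarrow> nat \<Rightarrow> nat" where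
  "prod_z_exp n l b = l mod gk_m n + b mod gk_m n"

definition prod_coeff :: "nat \<Rightarrow> nat \<Rightarrow> nat \<Rightarrow> 'k::comm_ring_1 poly" where
  "prod_coeff n l b = gk_aP n ^ (prod_y_exp n l b div (n+1)) * gk_hP n ^ (prod_z_exp n l b div gk_m n)"
definition prod_index :: "nat \<Rightarrow> nat \<Rightarrow> nat \<Rightarrow> nat" where
  "prod_index n l b = (prod_y_exp n l b mod (n+1)) * gk_m n + prod_z_exp n l b mod gk_m n"

lemma gk_m_pos: "0 < gk_m n" by (simp add: gk_m_def)

lemma gk_deg_pos: "0 < gk_deg n" by (simp add: gk_deg_def gk_m_def)

lemma gk_m_less_gk_deg: "0 < n \<Longrightarrow> gk_m n < gk_deg n"
  using gk_m_pos[of n] by (simp add: gk_deg_def)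

lemma one_less_gk_deg: "2 \<le> n \<Longrightarrow> 1 < gk_deg n"
  by (simp add: gk_deg_def gk_m_def power2_eq_square)

lemma prod_index_less: "prod_index n l b < gk_deg n"
proof -
  have "prod_y_exp n l b mod (n+1) \<le> n" by (simp add: less_Suc_eq_le[symmetric])
  hence "(prod_y_exp n l b mod (n+1)) * gk_m n \<le> n * gk_m n" by simp
  moreover have "prod_z_exp n l b mod gk_m n < gk_m n" using gk_m_pos by simp
  ultimately have "(prod_y_exp n l b mod (n+1)) * gk_m n + prod_z_exp n l b mod gk_m n < n * gk_m n + gk_m n"
    by linarith
  then show ?thesis unfolding prod_index_def gk_deg_def by (simp add: algebra_simps)
qed

lemma prod_index_div: "prod_index n l b div gk_m n = prod_y_exp n l b mod (n+1)"
  and prod_index_mod: "prod_index n l b mod gk_m n = prod_z_exp n l b mod gk_m n"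
  using gk_m_pos[of n] unfolding prod_index_def by simp_all

lemma monomial_reduce:
  fixes y z A H :: "'F::comm_ring_1"
  assumes y: "y ^ (n+1) = A" and z: "z ^ gk_m n = y * H"
  shows "y ^ I * z ^ J = A ^ ((I + J div gk_m n) div (n+1)) * H ^ (J div gk_m n)
           * y ^ ((I + J div gk_m n) mod (n+1)) * z ^ (J mod gk_m n)"
proof -
  have zJ: "z ^ J = (y*H) ^ (J div gk_m n) * z ^ (J mod gk_m n)"
    by (metis div_mult_mod_eq power_add power_mult z mult.commute)
  have yI: "y ^ (I + J div gk_m n) = A ^ ((I + J div gk_m n) div (n+1)) * y ^ ((I + J div gk_m n) mod (n+1))"
    by (metis div_mult_mod_eq power_add power_mult y mult.commute)
  have "y ^ I * z ^ J = y ^ (I + J div gk_m n) * H ^ (J div gk_m n) * z ^ (J mod gk_m n)"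
    unfolding zJ by (simp add: power_mult_distrib power_add algebra_simps)
  also have "\<dots> = A ^ ((I + J div gk_m n) div (n+1)) * H ^ (J div gk_m n)
           * y ^ ((I + J div gk_m n) mod (n+1)) * z ^ (J mod gk_m n)"
    unfolding yI by (simp add: algebra_simps)
  finally show ?thesis .
qed

lemma gk_monomial_mult:
  fixes y z :: "'F::comm_ring_1" and \<rho> :: "'k::comm_ring_1 poly \<Rightarrow> 'F"
  assumes hom: "comm_ring_hom \<rho>"
    and y: "y ^ (n+1) = \<rho> (gk_aP n)" and z: "z ^ gk_m n = y * \<rho> (gk_hP n)"
  shows "gk_monomial n y z l * gk_monomial n y z b = \<rho> (prod_coeff n l b) * gk_monomial n y z (prod_index n l b)"
proof -
  interpret comm_ring_hom \<rho> by fact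
  have "gk_monomial n y z l * gk_monomial n y z b = y ^ (l div gk_m n + b div gk_m n) * z ^ (prod_z_exp n l b)"
    unfolding gk_monomial_def prod_z_exp_def by (simp add: power_add algebra_simps)
  also have "\<dots> = \<rho> (gk_aP n) ^ (prod_y_exp n l b div (n+1)) * \<rho> (gk_hP n) ^ (prod_z_exp n l b div gk_m n)
           * y ^ (prod_y_exp n l b mod (n+1)) * z ^ (prod_z_exp n l b mod gk_m n)"
    unfolding monomial_reduce[OF y z] prod_y_exp_def prod_z_exp_def by simp
  also have "\<dots> = \<rho> (prod_coeff n l b) * gk_monomial n y z (prod_index n l b)"
    unfolding prod_coeff_def gk_monomial_def prod_index_div prod_index_mod by (simp add: hom_distribs algebra_simps)
  finally show ?thesis .
qed

lemma gk_monomial_0: "gk_monomial n y z 0 = 1"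
  unfolding gk_monomial_def by simp

lemma gk_monomial_1: "2 \<le> n \<Longrightarrow> gk_monomial n y z 1 = z"
  unfolding gk_monomial_def gk_m_def by (simp add: power2_eq_square)

lemma gk_monomial_gk_m: "gk_monomial n y z (gk_m n) = y"
  unfolding gk_monomial_def using gk_m_pos[of n] by simp

text \<open>Elements are given by coordinate vectors over k[X] with respect to the monomial basis;
  \<open>\<rho>\<close> plays the role of p \<mapsto> p(x).\<close>
definition gk_eval :: "nat \<Rightarrow> ('k::comm_ring_1 poly \<Rightarrow> 'F::comm_ring_1) \<Rightarrow> 'F \<Rightarrow> 'F \<Rightarrow> 'k poly vec \<Rightarrow> 'F" where
  "gk_eval n \<rho> y z c = (\<Sum>l<gk_deg n. \<rho> (c $ l) * gk_monomial n y z l)"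

definition mult_mat :: "nat \<Rightarrow> 'k::comm_ring_1 poly vec \<Rightarrow> 'k poly mat" where
  "mult_mat n c = mat (gk_deg n) (gk_deg n)
     (\<lambda>(a,b). \<Sum>l<gk_deg n. if prod_index n l b = a then c $ l * prod_coeff n l b else 0)"

lemma mult_mat_carrier: "mult_mat n c \<in> carrier_mat (gk_deg n) (gk_deg n)"
  unfolding mult_mat_def by simp

lemma mult_mat_mult_vec_nth:
  assumes "u \<in> carrier_vec (gk_deg n)" and "a < gk_deg n"
  shows "(mult_mat n c *\<^sub>v u) $ a =
    (\<Sum>b<gk_deg n. (\<Sum>l<gk_deg n. if prod_index n l b = a then c $ l * prod_coeff n l b else 0) * u $ b)"
  using assms unfolding mult_mat_def by (simp add: scalar_prod_def lessThan_atLeast0)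

context
  fixes \<rho> :: "'k::comm_ring_1 poly \<Rightarrow> 'F::comm_ring_1"
  assumes hom: "comm_ring_hom \<rho>"
begin

interpretation comm_ring_hom \<rho> by (rule hom)

lemma gk_eval_add: "c \<in> carrier_vec (gk_deg n) \<Longrightarrow> u \<in> carrier_vec (gk_deg n) \<Longrightarrow>
   gk_eval n \<rho> y z (c + u) = gk_eval n \<rho> y z c + gk_eval n \<rho> y z u"
  unfolding gk_eval_def by (simp add: hom_add distrib_right sum.distrib)

lemma gk_eval_diff: "c \<in> carrier_vec (gk_deg n) \<Longrightarrow> u \<in> carrier_vec (gk_deg n) \<Longrightarrow>
   gk_eval n \<rho> y z (c - u) = gk_eval n \<rho> y z c - gk_eval n \<rho> y z u"
  unfolding gk_eval_def by (simp add: hom_minus left_diff_distrib sum_subtractf)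

lemma gk_eval_smult: "c \<in> carrier_vec (gk_deg n) \<Longrightarrow> gk_eval n \<rho> y z (p \<cdot>\<^sub>v c) = \<rho> p * gk_eval n \<rho> y z c"
  unfolding gk_eval_def by (simp add: hom_mult sum_distrib_left ac_simps)

lemma gk_eval_zero: "gk_eval n \<rho> y z (0\<^sub>v (gk_deg n)) = 0"
  unfolding gk_eval_def by simp

lemma gk_eval_unit_vec: "l < gk_deg n \<Longrightarrow> gk_eval n \<rho> y z (unit_vec (gk_deg n) l) = gk_monomial n y z l"
proof -
  assume l: "l < gk_deg n"
  have "gk_eval n \<rho> y z (unit_vec (gk_deg n) l) = (\<Sum>la<gk_deg n. (if la = l then 1 else 0) * gk_monomial n y z la)"
    unfolding gk_eval_def by (intro sum.cong refl) (simp add: unit_vec_def)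
  also have "\<dots> = (\<Sum>la<gk_deg n. if la = l then gk_monomial n y z l else 0)"
    by (rule sum.cong) auto
  also have "\<dots> = gk_monomial n y z l" using l by simp
  finally show ?thesis .
qed

lemma gk_eval_const: "gk_eval n \<rho> y z (p \<cdot>\<^sub>v unit_vec (gk_deg n) 0) = \<rho> p"
  by (simp add: gk_eval_smult[OF unit_vec_carrier] gk_eval_unit_vec[OF gk_deg_pos] gk_monomial_0)

lemma gk_eval_y: "0 < n \<Longrightarrow> gk_eval n \<rho> y z (unit_vec (gk_deg n) (gk_m n)) = y"
  by (simp add: gk_eval_unit_vec gk_m_less_gk_deg gk_monomial_gk_m)

lemma gk_eval_z:
  assumes "2 \<le> n"
  shows "gk_eval n \<rho> y z (unit_vec (gk_deg n) 1) = z"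
  using gk_eval_unit_vec[OF one_less_gk_deg[OF assms]] gk_monomial_1[OF assms] by simp

lemma gk_eval_mult_mat_mult_vec:
  assumes u: "u \<in> carrier_vec (gk_deg n)"
  shows "gk_eval n \<rho> y z (mult_mat n c *\<^sub>v u) = (\<Sum>b<gk_deg n. \<Sum>l<gk_deg n.
           \<rho> (c $ l) * \<rho> (prod_coeff n l b) * \<rho> (u $ b) * gk_monomial n y z (prod_index n l b))"
proof -
  let ?D = "gk_deg n"
  let ?B = "gk_monomial n y z"
  let ?t = "\<lambda>a b l. if prod_index n l b = a then \<rho> (c $ l) * \<rho> (prod_coeff n l b) * \<rho> (u $ b) * ?B a else 0"
  have entry: "\<rho> ((mult_mat n c *\<^sub>v u) $ a) * ?B a = (\<Sum>b<?D. \<Sum>l<?D. ?t a b l)" if "a < ?D" for a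
  proof -
    have "\<rho> ((mult_mat n c *\<^sub>v u) $ a) = (\<Sum>b<?D. (\<Sum>l<?D. \<rho> (if prod_index n l b = a then c $ l * prod_coeff n l b else 0)) * \<rho> (u $ b))"
      unfolding mult_mat_mult_vec_nth[OF u that] hom_sum hom_mult ..
    also have "\<dots> = (\<Sum>b<?D. \<Sum>l<?D. if prod_index n l b = a then \<rho> (c $ l) * \<rho> (prod_coeff n l b) * \<rho> (u $ b) else 0)"
      unfolding sum_distrib_right by (intro sum.cong refl) (simp add: hom_mult)
    finally have R: "\<rho> ((mult_mat n c *\<^sub>v u) $ a) = (\<Sum>b<?D. \<Sum>l<?D. if prod_index n l b = a then \<rho> (c $ l) * \<rho> (prod_coeff n l b) * \<rho> (u $ b) else 0)" .
    show ?thesis unfolding R sum_distrib_right by (intro sum.cong refl) simp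
  qed
  have "gk_eval n \<rho> y z (mult_mat n c *\<^sub>v u) = (\<Sum>a<?D. \<Sum>b<?D. \<Sum>l<?D. ?t a b l)"
    unfolding gk_eval_def by (intro sum.cong refl) (simp add: entry)
  also have "\<dots> = (\<Sum>b<?D. \<Sum>l<?D. \<Sum>a<?D. ?t a b l)"
    by (rule trans[OF sum.swap]) (rule sum.cong[OF refl], rule sum.swap)
  also have "\<dots> = (\<Sum>b<?D. \<Sum>l<?D. \<rho> (c $ l) * \<rho> (prod_coeff n l b) * \<rho> (u $ b) * ?B (prod_index n l b))"
    by (intro sum.cong refl) (simp add: sum.delta prod_index_less)
  finally show ?thesis .
qed

lemma gk_eval_mult:
  assumes y: "y ^ (n+1) = \<rho> (gk_aP n)" and z: "z ^ gk_m n = y * \<rho> (gk_hP n)"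
    and u: "u \<in> carrier_vec (gk_deg n)"
  shows "gk_eval n \<rho> y z c * gk_eval n \<rho> y z u = gk_eval n \<rho> y z (mult_mat n c *\<^sub>v u)"
proof -
  let ?D = "gk_deg n"
  let ?B = "gk_monomial n y z"
  have summand: "(\<rho> (c $ l) * ?B l) * (\<rho> (u $ b) * ?B b)
      = \<rho> (c $ l) * \<rho> (prod_coeff n l b) * \<rho> (u $ b) * ?B (prod_index n l b)" for l b
  proof -
    have "(\<rho> (c $ l) * ?B l) * (\<rho> (u $ b) * ?B b) = \<rho> (c $ l) * \<rho> (u $ b) * (?B l * ?B b)"
      by (simp add: ac_simps)
    also have "\<dots> = \<rho> (c $ l) * \<rho> (u $ b) * (\<rho> (prod_coeff n l b) * ?B (prod_index n l b))"
      by (simp add: gk_monomial_mult[OF hom y z])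
    finally show ?thesis by (simp add: ac_simps)
  qed
  have "gk_eval n \<rho> y z c * gk_eval n \<rho> y z u = (\<Sum>l<?D. \<Sum>b<?D. (\<rho> (c $ l) * ?B l) * (\<rho> (u $ b) * ?B b))"
    unfolding gk_eval_def sum_product ..
  also have "\<dots> = (\<Sum>b<?D. \<Sum>l<?D. (\<rho> (c $ l) * ?B l) * (\<rho> (u $ b) * ?B b))"
    by (rule sum.swap)
  also have "\<dots> = gk_eval n \<rho> y z (mult_mat n c *\<^sub>v u)"
    unfolding gk_eval_mult_mat_mult_vec[OF u]
    by (intro sum.cong refl) (rule summand)
  finally show ?thesis .
qed

end

text \<open>Cofactors give an inverse of a combination up to the determinant of its multiplication matrix.\<close>
definition cofactor_vec :: "nat \<Rightarrow> 'k::comm_ring_1 poly vec \<Rightarrow> 'k poly vec" where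
  "cofactor_vec n c = adj_mat (mult_mat n c) *\<^sub>v unit_vec (gk_deg n) 0"

definition mult_det :: "nat \<Rightarrow> 'k::comm_ring_1 poly vec \<Rightarrow> 'k poly" where
  "mult_det n c = det (mult_mat n c)"

lemma smult_one_mat_mult_vec:
  assumes "v \<in> carrier_vec N"
  shows "(d \<cdot>\<^sub>m 1\<^sub>m N) *\<^sub>v v = d \<cdot>\<^sub>v (v :: 'a::comm_ring_1 vec)"
proof (intro eq_vecI)
  fix i assume "i < dim_vec (d \<cdot>\<^sub>v v)"
  then have i: "i < N" using assms by simp
  have "((d \<cdot>\<^sub>m 1\<^sub>m N) *\<^sub>v v) $ i = (\<Sum>ia = 0..<N. (if ia = i then d else 0) * v $ ia)"
    using i assms by (simp add: scalar_prod_def) (intro sum.cong refl, simp)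
  also have "\<dots> = (\<Sum>ia = 0..<N. if ia = i then d * v $ i else 0)"
    by (rule sum.cong) auto
  also have "\<dots> = d * v $ i" using i by simp
  finally show "((d \<cdot>\<^sub>m 1\<^sub>m N) *\<^sub>v v) $ i = (d \<cdot>\<^sub>v v) $ i" using i assms by simp
qed (use assms in simp)

lemma cofactor_vec_carrier: "cofactor_vec n c \<in> carrier_vec (gk_deg n)"
  unfolding cofactor_vec_def using adj_mat(1)[OF mult_mat_carrier[of n c]] by (intro mult_mat_vec_carrier) auto

lemma mult_mat_cofactor_vec: "mult_mat n c *\<^sub>v cofactor_vec n c = mult_det n c \<cdot>\<^sub>v unit_vec (gk_deg n) 0"
proof -
  have "mult_mat n c *\<^sub>v cofactor_vec n c = (mult_mat n c * adj_mat (mult_mat n c)) *\<^sub>v unit_vec (gk_deg n) 0"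
    unfolding cofactor_vec_def using adj_mat(1)[OF mult_mat_carrier[of n c]] mult_mat_carrier[of n c] by simp
  also have "\<dots> = mult_det n c \<cdot>\<^sub>v unit_vec (gk_deg n) 0"
    unfolding adj_mat(2)[OF mult_mat_carrier] mult_det_def by (rule smult_one_mat_mult_vec) simp
  finally show ?thesis .
qed

lemma gk_eval_cofactor_vec:
  fixes y z :: "'F::comm_ring_1" and \<rho> :: "'k::comm_ring_1 poly \<Rightarrow> 'F"
  assumes hom: "comm_ring_hom \<rho>"
    and y: "y ^ (n+1) = \<rho> (gk_aP n)" and z: "z ^ gk_m n = y * \<rho> (gk_hP n)"
  shows "gk_eval n \<rho> y z c * gk_eval n \<rho> y z (cofactor_vec n c) = \<rho> (mult_det n c)"
proof -
  have "gk_eval n \<rho> y z c * gk_eval n \<rho> y z (cofactor_vec n c) = gk_eval n \<rho> y z (mult_mat n c *\<^sub>v cofactor_vec n c)"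
    by (rule gk_eval_mult[OF hom y z cofactor_vec_carrier])
  also have "\<dots> = \<rho> (mult_det n c)"
    unfolding mult_mat_cofactor_vec gk_eval_smult[OF hom unit_vec_carrier] gk_eval_unit_vec[OF hom gk_deg_pos] gk_monomial_0 by simp
  finally show ?thesis .
qed

section \<open>A model of the function field in Laurent series\<close>

lemma comm_ring_hom_poly_eval:
  assumes "comm_ring_hom \<iota>"
  shows "comm_ring_hom (\<lambda>p. poly (map_poly \<iota> p) \<xi>)"
proof -
  interpret map_poly_comm_ring_hom \<iota> using assms by (simp add: map_poly_comm_ring_hom_def)
  show ?thesis by unfold_locales (simp_all add: hom_distribs)
qed

lemma comm_ring_hom_fps_const: "comm_ring_hom (fps_const :: 'a::comm_ring_1 \<Rightarrow> 'a fps)"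
  by unfold_locales (simp_all add: fps_const_add fps_const_mult)

lemma comm_ring_hom_fps_to_fls: "comm_ring_hom (fps_to_fls :: 'a::comm_ring_1 fps \<Rightarrow> 'a fls)"
  by unfold_locales (simp_all add: fls_times_fps_to_fls)

definition fps_poly_X_pow :: "nat \<Rightarrow> 'k::field poly \<Rightarrow> 'k fps" where
  "fps_poly_X_pow d p = poly (map_poly fps_const p) (fps_X ^ d)"

definition fls_poly_X_pow :: "nat \<Rightarrow> 'k::field poly \<Rightarrow> 'k fls" where
  "fls_poly_X_pow d p = fps_to_fls (fps_poly_X_pow d p)"

lemma fps_poly_X_pow_hom: "comm_ring_hom (fps_poly_X_pow d :: 'k::field poly \<Rightarrow> 'k fps)"
  unfolding fps_poly_X_pow_def by (rule comm_ring_hom_poly_eval[OF comm_ring_hom_fps_const])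

lemma fls_poly_X_pow_hom: "comm_ring_hom (fls_poly_X_pow d :: 'k::field poly \<Rightarrow> 'k fls)"
proof -
  interpret a: comm_ring_hom "fps_poly_X_pow d :: 'k poly \<Rightarrow> 'k fps" by (rule fps_poly_X_pow_hom)
  interpret b: comm_ring_hom "fps_to_fls :: 'k fps \<Rightarrow> 'k fls" by (rule comm_ring_hom_fps_to_fls)
  show ?thesis
    unfolding fls_poly_X_pow_def by unfold_locales (simp_all add: a.hom_add a.hom_mult b.hom_add b.hom_mult)
qed

lemma fps_poly_X_pow_pCons: "fps_poly_X_pow d (pCons a p) = fps_const a + fps_X ^ d * fps_poly_X_pow d p"
  unfolding fps_poly_X_pow_def by (cases "a = 0 \<and> p = 0") (auto simp: map_poly_pCons)

lemma fps_poly_X_pow_nth_0: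
  assumes "0 < d"
  shows "fps_poly_X_pow d p $ 0 = poly p 0"
proof (induct p)
  case 0 then show ?case by (simp add: fps_poly_X_pow_def)
next
  case (pCons a p) then show ?case
    unfolding fps_poly_X_pow_pCons using assms by simp
qed

lemma fps_poly_X_pow_nonzero:
  assumes "0 < d" and "p \<noteq> 0"
  shows "fps_poly_X_pow d p \<noteq> 0 \<and> d dvd subdegree (fps_poly_X_pow d p)"
  using assms(2)
proof (induct p)
  case 0 then show ?case by simp
next
  case (pCons a p)
  show ?case
  proof (cases "a = 0")
    case False
    have "fps_poly_X_pow d (pCons a p) $ 0 = a" using fps_poly_X_pow_nth_0[OF assms(1), of "pCons a p"] by simp
    with False show ?thesis by auto
  next
    case True
    then have "p \<noteq> 0" using pCons by auto
    with pCons have ih: "fps_poly_X_pow d p \<noteq> 0" "d dvd subdegree (fps_poly_X_pow d p)" by auto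
    have eq: "fps_poly_X_pow d (pCons a p) = fps_X ^ d * fps_poly_X_pow d p"
      using True by (simp add: fps_poly_X_pow_pCons)
    have "subdegree (fps_X ^ d * fps_poly_X_pow d p) = d + subdegree (fps_poly_X_pow d p)"
      using ih by (simp add: subdegree_mult)
    then show ?thesis using eq ih by simp
  qed
qed

lemma fls_sum_nonzero_if_distinct_subdegrees:
  fixes f :: "'i \<Rightarrow> 'a::field fls"
  assumes fin: "finite S"
    and dist: "\<And>l l'. l \<in> S \<Longrightarrow> l' \<in> S \<Longrightarrow> f l \<noteq> 0 \<Longrightarrow> f l' \<noteq> 0 \<Longrightarrow>
                 fls_subdegree (f l) = fls_subdegree (f l') \<Longrightarrow> l = l'"
    and "m \<in> S" "f m \<noteq> 0"
  shows "sum f S \<noteq> 0"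
proof -
  let ?T = "{l\<in>S. f l \<noteq> 0}"
  have finT: "finite ?T" using fin by simp
  have neT: "?T \<noteq> {}" using assms(3,4) by auto
  define lm where "lm = arg_min_on (\<lambda>l. fls_subdegree (f l)) ?T"
  have lmT: "lm \<in> ?T" unfolding lm_def by (rule arg_min_if_finite(1)[OF finT neT])
  have lmin: "fls_subdegree (f lm) \<le> fls_subdegree (f l)" if "l \<in> ?T" for l
    unfolding lm_def by (rule arg_min_least[OF finT neT that])
  define d where "d = fls_subdegree (f lm)"
  have other: "fls_nth (f l) d = 0" if "l \<in> S" "l \<noteq> lm" for l
  proof (cases "f l = 0")
    case False
    then have "l \<in> ?T" using that by simp
    from lmin[OF this] have "d \<le> fls_subdegree (f l)" unfolding d_def .
    moreover have "d \<noteq> fls_subdegree (f l)"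
      using dist[of lm l] lmT that False unfolding d_def by auto
    ultimately show ?thesis by simp
  qed simp
  have "fls_nth (sum f S) d = (\<Sum>l\<in>S. fls_nth (f l) d)" by (rule fls_nth_sum)
  also have "\<dots> = fls_nth (f lm) d"
    using lmT other by (subst sum.remove[of _ lm]) (auto simp: fin intro!: sum.neutral)
  also have "\<dots> \<noteq> 0" unfolding d_def using lmT by simp
  finally show ?thesis by auto
qed

lemma poly_gk_hP_0:
  assumes "2 \<le> n"
  shows "poly (gk_hP n :: 'k::comm_ring_1 poly) 0 = -1"
proof -
  have "poly (gk_hP n :: 'k poly) 0 = (\<Sum>i\<le>n. (-1)^(i+1) * (0::'k)^(i*(n-1)))"
    unfolding gk_hP_def by (simp add: poly_sum)
  also have "\<dots> = (-1)^(0+1) * (0::'k)^(0*(n-1)) + (\<Sum>i<n. (-1)^(Suc i+1) * (0::'k)^(Suc i*(n-1)))"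
    by (rule sum.atMost_shift)
  also have "(\<Sum>i<n. (-1)^(Suc i+1) * (0::'k)^(Suc i*(n-1))) = 0"
    using assms by (intro sum.neutral) (simp add: power_0_left)
  finally show ?thesis by simp
qed

definition gk_U :: "nat \<Rightarrow> 'k::field fps" where
  "gk_U n = (SOME U. U ^ (n+1) = 1 + fps_X ^ (gk_deg n * (n-1)) \<and> U $ 0 = 1)"

definition gk_V :: "nat \<Rightarrow> 'k::field fps" where
  "gk_V n = (SOME V. V ^ (gk_m n) = gk_U n * fps_poly_X_pow (gk_deg n) (gk_hP n) \<and> V $ 0 = -1)"

definition gk_Y :: "nat \<Rightarrow> 'k::field fls" where
  "gk_Y n = fls_X ^ (gk_m n) * fps_to_fls (gk_U n)"

definition gk_Z :: "nat \<Rightarrow> 'k::field fls" where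
  "gk_Z n = fls_X * fps_to_fls (gk_V n)"

text \<open>Oddness of m makes -1 an m-th root of -1, the constant term of U h(t^(n^3+1)).\<close>
locale gk_char =
  fixes n :: nat and ty :: "'k::field itself"
  assumes n_ge_2: "2 \<le> n"
    and char_n_Suc: "(of_nat (n+1) :: 'k) \<noteq> 0"
    and char_gk_m: "(of_nat (gk_m n) :: 'k) \<noteq> 0"
    and odd_gk_m: "odd (gk_m n)"
begin

abbreviation poly_series :: "'k poly \<Rightarrow> 'k fls" where
  "poly_series \<equiv> fls_poly_X_pow (gk_deg n)"

lemma gk_U_root: "(gk_U n :: 'k fps) ^ (n+1) = 1 + fps_X ^ (gk_deg n * (n-1)) \<and> gk_U n $ 0 = (1::'k)"
proof -
  have pos: "0 < gk_deg n * (n-1)" using n_ge_2 gk_deg_pos[of n] by simp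
  have "\<exists>b::'k fps. b ^ (n+1) = 1 + fps_X ^ (gk_deg n * (n-1)) \<and> b $ 0 = 1"
    by (rule fps_nth_root_exists) (use char_n_Suc pos in auto)
  then show ?thesis unfolding gk_U_def by (rule someI_ex)
qed

lemma gk_V_root: "(gk_V n :: 'k fps) ^ (gk_m n) = gk_U n * fps_poly_X_pow (gk_deg n) (gk_hP n) \<and> gk_V n $ 0 = (-1::'k)"
proof -
  have "fps_poly_X_pow (gk_deg n) (gk_hP n) $ 0 = (-1::'k)"
    by (simp add: fps_poly_X_pow_nth_0[OF gk_deg_pos] poly_gk_hP_0[OF n_ge_2])
  then have "\<exists>b::'k fps. b ^ (gk_m n) = gk_U n * fps_poly_X_pow (gk_deg n) (gk_hP n) \<and> b $ 0 = -1"
    by (intro fps_nth_root_exists) (use char_gk_m odd_gk_m gk_m_pos[of n] gk_U_root in auto)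
  then show ?thesis unfolding gk_V_def by (rule someI_ex)
qed

lemma gk_Y_power: "(gk_Y n :: 'k fls) ^ (n+1) = poly_series (gk_aP n)"
proof -
  interpret G: comm_ring_hom "fps_poly_X_pow (gk_deg n) :: 'k poly \<Rightarrow> 'k fps" by (rule fps_poly_X_pow_hom)
  have gk_deg_eq: "gk_deg n = gk_m n * (n+1)" by (simp add: gk_deg_def)
  have GX: "fps_poly_X_pow (gk_deg n) [:0,1:] = (fps_X ^ gk_deg n :: 'k fps)"
    unfolding fps_poly_X_pow_def by (simp add: map_poly_pCons)
  have "(gk_Y n :: 'k fls) ^ (n+1) = fls_X ^ (gk_m n * (n+1)) * fps_to_fls (gk_U n ^ (n+1))"
    unfolding gk_Y_def by (simp only: power_mult_distrib power_mult fps_to_fls_power)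
  also have "\<dots> = fls_X ^ gk_deg n * fps_to_fls (1 + fps_X ^ (gk_deg n * (n-1)))"
    using gk_U_root gk_deg_eq by simp
  also have "\<dots> = fps_to_fls (fps_X ^ gk_deg n * (1 + fps_X ^ (gk_deg n * (n-1))))"
    by (simp add: fls_times_fps_to_fls fps_to_fls_power)
  also have "fps_X ^ gk_deg n * (1 + fps_X ^ (gk_deg n * (n-1))) = (fps_X ^ gk_deg n) ^ n + (fps_X ^ gk_deg n :: 'k fps)"
  proof -
    have "gk_deg n + gk_deg n * (n-1) = gk_deg n * n" using n_ge_2 by (cases n) (simp_all add: algebra_simps)
    then show ?thesis by (simp add: algebra_simps power_add[symmetric] power_mult[symmetric])
  qed
  also have "\<dots> = fps_poly_X_pow (gk_deg n) (gk_aP n)" unfolding gk_aP_def by (simp add: G.hom_add G.hom_power GX)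
  finally show ?thesis unfolding fls_poly_X_pow_def .
qed

lemma gk_Z_power: "(gk_Z n :: 'k fls) ^ (gk_m n) = gk_Y n * poly_series (gk_hP n)"
proof -
  have "(gk_Z n :: 'k fls) ^ (gk_m n) = fls_X ^ gk_m n * fps_to_fls (gk_V n ^ gk_m n)"
    unfolding gk_Z_def by (simp add: power_mult_distrib fps_to_fls_power)
  also have "\<dots> = fls_X ^ gk_m n * (fps_to_fls (gk_U n) * fps_to_fls (fps_poly_X_pow (gk_deg n) (gk_hP n)))"
    using gk_V_root by (simp add: fls_times_fps_to_fls)
  finally show ?thesis unfolding gk_Y_def fls_poly_X_pow_def by (simp add: ac_simps)
qed

lemma gk_Y_nonzero: "(gk_Y n :: 'k fls) \<noteq> 0"
  and gk_Y_subdegree: "fls_subdegree (gk_Y n :: 'k fls) = int (gk_m n)"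
proof -
  have "fps_to_fls (gk_U n :: 'k fps) \<noteq> 0" "fls_subdegree (fps_to_fls (gk_U n :: 'k fps)) = 0"
    using gk_U_root by (auto simp: fls_subdegree_fls_to_fps)
  then show "(gk_Y n :: 'k fls) \<noteq> 0" "fls_subdegree (gk_Y n :: 'k fls) = int (gk_m n)"
    unfolding gk_Y_def by (simp_all add: fls_subdegree_pow)
qed

lemma gk_Z_nonzero: "(gk_Z n :: 'k fls) \<noteq> 0"
  and gk_Z_subdegree: "fls_subdegree (gk_Z n :: 'k fls) = 1"
proof -
  have "fps_to_fls (gk_V n :: 'k fps) \<noteq> 0" "fls_subdegree (fps_to_fls (gk_V n :: 'k fps)) = 0"
    using gk_V_root by (auto simp: fls_subdegree_fls_to_fps)
  then show "(gk_Z n :: 'k fls) \<noteq> 0" "fls_subdegree (gk_Z n :: 'k fls) = 1"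
    unfolding gk_Z_def by simp_all
qed

lemma poly_series_nonzero:
  assumes "p \<noteq> 0"
  shows "poly_series p \<noteq> 0"
  using fps_poly_X_pow_nonzero[OF gk_deg_pos[of n] assms] unfolding fls_poly_X_pow_def by simp

lemma subdegree_gk_monomial_series:
  "gk_monomial n (gk_Y n) (gk_Z n :: 'k fls) l \<noteq> 0 \<and> fls_subdegree (gk_monomial n (gk_Y n) (gk_Z n :: 'k fls) l) = int l"
proof -
  have "int (gk_m n) * int (l div gk_m n) + int (l mod gk_m n) = int l"
    by (metis div_mult_mod_eq of_nat_add of_nat_mult mult.commute)
  then show ?thesis unfolding gk_monomial_def using gk_Y_nonzero gk_Z_nonzero gk_Y_subdegree gk_Z_subdegree
    by (simp add: fls_subdegree_pow ac_simps)
qed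

abbreviation series :: "'k poly vec \<Rightarrow> 'k fls" where
  "series \<equiv> gk_eval n poly_series (gk_Y n) (gk_Z n)"

text \<open>The orders of the nonzero summands of \<open>series c\<close> are pairwise incongruent modulo n^3 + 1.\<close>
lemma series_eq_0_imp_zero_vec:
  assumes c: "c \<in> carrier_vec (gk_deg n)" and z: "series c = 0"
  shows "c = 0\<^sub>v (gk_deg n)"
proof (rule ccontr)
  assume "c \<noteq> 0\<^sub>v (gk_deg n)"
  then obtain l0 where l0: "l0 < gk_deg n" "c $ l0 \<noteq> 0" using c by (auto simp: vec_eq_iff)
  let ?f = "\<lambda>l. poly_series (c $ l) * gk_monomial n (gk_Y n) (gk_Z n :: 'k fls) l"
  have trm: "?f l \<noteq> 0 \<and> (\<exists>q. fls_subdegree (?f l) = int (gk_deg n * q + l))" if "c $ l \<noteq> 0" for l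
  proof -
    from fps_poly_X_pow_nonzero[OF gk_deg_pos[of n] that] obtain q
      where g: "fps_poly_X_pow (gk_deg n) (c $ l) \<noteq> 0" "subdegree (fps_poly_X_pow (gk_deg n) (c $ l)) = gk_deg n * q"
      by (auto elim: dvdE)
    have r: "poly_series (c $ l) \<noteq> 0" "fls_subdegree (poly_series (c $ l)) = int (gk_deg n * q)"
      unfolding fls_poly_X_pow_def using g by (simp_all add: fls_subdegree_fls_to_fps)
    show ?thesis using r subdegree_gk_monomial_series[of l] by auto
  qed
  have "sum ?f {..<gk_deg n} \<noteq> 0"
  proof (rule fls_sum_nonzero_if_distinct_subdegrees[where m = l0])
    fix l l' assume ll: "l \<in> {..<gk_deg n}" "l' \<in> {..<gk_deg n}" "?f l \<noteq> 0" "?f l' \<noteq> 0"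
      "fls_subdegree (?f l) = fls_subdegree (?f l')"
    have "c $ l \<noteq> 0" "c $ l' \<noteq> 0" using ll(3,4) by (auto simp: fls_poly_X_pow_def fps_poly_X_pow_def)
    from trm[OF this(1)] trm[OF this(2)] ll(5) obtain q q' where
      "int (gk_deg n * q + l) = int (gk_deg n * q' + l')" by auto
    then have "gk_deg n * q + l = gk_deg n * q' + l'" by (simp only: of_nat_eq_iff)
    then have "(gk_deg n * q + l) mod gk_deg n = (gk_deg n * q' + l') mod gk_deg n" by simp
    then show "l = l'" using ll(1,2) by simp
  qed (use l0 trm in auto)
  with z show False unfolding gk_eval_def by simp
qed

lemma mult_det_nonzero:
  assumes c: "c \<in> carrier_vec (gk_deg n)" "c \<noteq> 0\<^sub>v (gk_deg n)"
  shows "mult_det n c \<noteq> (0 :: 'k poly)"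
proof
  assume "mult_det n c = 0"
  then obtain v where v: "v \<in> carrier_vec (gk_deg n)" "v \<noteq> 0\<^sub>v (gk_deg n)" "mult_mat n c *\<^sub>v v = 0\<^sub>v (gk_deg n)"
    unfolding mult_det_def using det_0_iff_vec_prod_zero[OF mult_mat_carrier] by blast
  have "series c * series v = 0"
    using gk_eval_mult[OF fls_poly_X_pow_hom gk_Y_power gk_Z_power v(1), of c] v(3) gk_eval_zero[OF fls_poly_X_pow_hom] by simp
  then show False using series_eq_0_imp_zero_vec c v by auto
qed

end

section \<open>The valuation at P_0\<close>

lemma comm_ring_hom_field_emb: "field_emb e \<Longrightarrow> comm_ring_hom e"
  unfolding field_emb_def by unfold_locales auto

locale gk_field = gk_char n ty for n and ty :: "'k::field itself" +
  fixes e :: "'k \<Rightarrow> 'L::field" and x y z :: 'L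
  assumes field_emb_e: "field_emb e"
    and x_transcendental: "\<And>p::'k poly. p \<noteq> 0 \<Longrightarrow> poly (map_poly e p) x \<noteq> 0"
    and generated: "\<And>S. is_subfield S \<Longrightarrow> range e \<subseteq> S \<Longrightarrow> x \<in> S \<Longrightarrow> y \<in> S \<Longrightarrow> z \<in> S \<Longrightarrow> S = UNIV"
    and z_equation: "z ^ (n^2 - n + 1) = y * gk_h n x"
    and y_equation: "x ^ n + x = y ^ (n + 1)"
begin

definition eval_x :: "'k poly \<Rightarrow> 'L" where "eval_x p = poly (map_poly e p) x"

lemma eval_x_hom: "comm_ring_hom eval_x"
  unfolding eval_x_def by (rule comm_ring_hom_poly_eval[OF comm_ring_hom_field_emb[OF field_emb_e]])

interpretation L: comm_ring_hom eval_x by (rule eval_x_hom)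
interpretation E: comm_ring_hom e by (rule comm_ring_hom_field_emb[OF field_emb_e])
interpretation F: comm_ring_hom poly_series by (rule fls_poly_X_pow_hom)

lemma eval_x_nonzero: "p \<noteq> 0 \<Longrightarrow> eval_x p \<noteq> 0"
  unfolding eval_x_def by (rule x_transcendental)

lemma eval_x_X: "eval_x [:0,1:] = x"
  unfolding eval_x_def by (simp add: map_poly_pCons)

lemma eval_x_const: "eval_x [:a:] = e a"
  unfolding eval_x_def by (cases "a = 0") (auto simp: map_poly_pCons)

lemma y_power: "y ^ (n+1) = eval_x (gk_aP n)"
  unfolding gk_aP_def using y_equation by (simp add: L.hom_add L.hom_power eval_x_X)

lemma z_power: "z ^ gk_m n = y * eval_x (gk_hP n)"
proof -
  have "eval_x (gk_hP n) = gk_h n x"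
    unfolding gk_hP_def gk_h_def L.hom_sum
    by (intro sum.cong refl) (simp only: L.hom_mult L.hom_power eval_x_X eval_x_const E.hom_power E.hom_uminus E.hom_one)
  then show ?thesis using z_equation unfolding gk_m_def by simp
qed

abbreviation elem :: "'k poly vec \<Rightarrow> 'L" where
  "elem \<equiv> gk_eval n eval_x y z"

lemma elem_nonzero:
  assumes "c \<in> carrier_vec (gk_deg n)" and "c \<noteq> 0\<^sub>v (gk_deg n)"
  shows "elem c \<noteq> 0"
proof
  assume "elem c = 0"
  then have "eval_x (mult_det n c) = 0"
    using gk_eval_cofactor_vec[OF eval_x_hom y_power z_power, of c] by simp
  then show False using eval_x_nonzero mult_det_nonzero[OF assms] by blast
qed

definition fractions :: "'L set" where
  "fractions = {elem c / eval_x d | c d. c \<in> carrier_vec (gk_deg n) \<and> d \<noteq> 0}"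

lemma fractionsI: "c \<in> carrier_vec (gk_deg n) \<Longrightarrow> d \<noteq> 0 \<Longrightarrow> elem c / eval_x d \<in> fractions"
  unfolding fractions_def by blast

lemma fractionsE:
  assumes "a \<in> fractions"
  obtains c d where "c \<in> carrier_vec (gk_deg n)" "d \<noteq> 0" "eval_x d \<noteq> 0" "a = elem c / eval_x d"
  using assms eval_x_nonzero unfolding fractions_def by blast

lemma elem_in_fractions: "c \<in> carrier_vec (gk_deg n) \<Longrightarrow> elem c \<in> fractions"
  using fractionsI[of c 1] by simp

lemma fractions_add:
  assumes "a \<in> fractions" "b \<in> fractions"
  shows "a + b \<in> fractions"
proof -
  obtain c d where cd: "c \<in> carrier_vec (gk_deg n)" "d \<noteq> 0" "eval_x d \<noteq> 0" "a = elem c / eval_x d"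
    using assms(1) by (rule fractionsE)
  obtain c' d' where cd': "c' \<in> carrier_vec (gk_deg n)" "d' \<noteq> 0" "eval_x d' \<noteq> 0" "b = elem c' / eval_x d'"
    using assms(2) by (rule fractionsE)
  have "a + b = elem (d' \<cdot>\<^sub>v c + d \<cdot>\<^sub>v c') / eval_x (d * d')"
    unfolding cd(4) cd'(4) using cd cd'
    by (simp add: gk_eval_add[OF eval_x_hom] gk_eval_smult[OF eval_x_hom] L.hom_mult field_simps)
  then show ?thesis using fractionsI cd cd' by simp
qed

lemma fractions_diff:
  assumes "a \<in> fractions" "b \<in> fractions"
  shows "a - b \<in> fractions"
proof -
  obtain c d where cd: "c \<in> carrier_vec (gk_deg n)" "d \<noteq> 0" "eval_x d \<noteq> 0" "a = elem c / eval_x d"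
    using assms(1) by (rule fractionsE)
  obtain c' d' where cd': "c' \<in> carrier_vec (gk_deg n)" "d' \<noteq> 0" "eval_x d' \<noteq> 0" "b = elem c' / eval_x d'"
    using assms(2) by (rule fractionsE)
  have "a - b = elem (d' \<cdot>\<^sub>v c - d \<cdot>\<^sub>v c') / eval_x (d * d')"
    unfolding cd(4) cd'(4) using cd cd'
    by (simp add: gk_eval_diff[OF eval_x_hom] gk_eval_smult[OF eval_x_hom] L.hom_mult field_simps)
  then show ?thesis using fractionsI cd cd' by simp
qed

lemma fractions_mult:
  assumes "a \<in> fractions" "b \<in> fractions"
  shows "a * b \<in> fractions"
proof -
  obtain c d where cd: "c \<in> carrier_vec (gk_deg n)" "d \<noteq> 0" "eval_x d \<noteq> 0" "a = elem c / eval_x d"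
    using assms(1) by (rule fractionsE)
  obtain c' d' where cd': "c' \<in> carrier_vec (gk_deg n)" "d' \<noteq> 0" "eval_x d' \<noteq> 0" "b = elem c' / eval_x d'"
    using assms(2) by (rule fractionsE)
  have "a * b = elem (mult_mat n c *\<^sub>v c') / eval_x (d * d')"
    unfolding cd(4) cd'(4) using cd' by (simp add: gk_eval_mult[OF eval_x_hom y_power z_power, symmetric] L.hom_mult)
  then show ?thesis using fractionsI cd cd' mult_mat_carrier[of n c] by simp
qed

lemma fractions_inverse:
  assumes "a \<in> fractions"
  shows "inverse a \<in> fractions"
proof -
  obtain c d where cd: "c \<in> carrier_vec (gk_deg n)" "d \<noteq> 0" "eval_x d \<noteq> 0" "a = elem c / eval_x d"
    using assms by (rule fractionsE)
  show ?thesis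
  proof (cases "c = 0\<^sub>v (gk_deg n)")
    case True
    then show ?thesis using cd(4) fractionsI[of "0\<^sub>v (gk_deg n)" 1] by (simp add: gk_eval_zero[OF eval_x_hom])
  next
    case False
    have det: "mult_det n c \<noteq> 0" by (rule mult_det_nonzero[OF cd(1) False])
    have "inverse a = elem (d \<cdot>\<^sub>v cofactor_vec n c) / eval_x (mult_det n c)"
      unfolding cd(4) using cd elem_nonzero[OF cd(1) False] eval_x_nonzero[OF det]
        gk_eval_cofactor_vec[OF eval_x_hom y_power z_power, of c]
      by (simp add: gk_eval_smult[OF eval_x_hom cofactor_vec_carrier] field_simps)
    then show ?thesis using fractionsI[OF _ det] cofactor_vec_carrier[of n c] by simp
  qed
qed

lemma fractions_UNIV: "fractions = UNIV"
proof (rule generated)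
  show "is_subfield fractions"
    unfolding is_subfield_def
    using elem_in_fractions[of "0\<^sub>v (gk_deg n)"] elem_in_fractions[of "unit_vec (gk_deg n) 0"]
    by (simp add: fractions_add fractions_diff fractions_mult fractions_inverse
        gk_eval_zero[OF eval_x_hom] gk_eval_unit_vec[OF eval_x_hom gk_deg_pos] gk_monomial_0)
  show "range e \<subseteq> fractions"
    using elem_in_fractions[of "[:a:] \<cdot>\<^sub>v unit_vec (gk_deg n) 0" for a]
    by (auto simp: gk_eval_const[OF eval_x_hom] eval_x_const)
  show "x \<in> fractions"
    using elem_in_fractions[of "[:0,1:] \<cdot>\<^sub>v unit_vec (gk_deg n) 0"]
    by (simp add: gk_eval_const[OF eval_x_hom] eval_x_X)
  show "y \<in> fractions"
    using elem_in_fractions[of "unit_vec (gk_deg n) (gk_m n)"] n_ge_2 by (simp add: gk_eval_y[OF eval_x_hom])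
  have "elem (unit_vec (gk_deg n) 1) = z" by (rule gk_eval_z[OF eval_x_hom n_ge_2])
  then show "z \<in> fractions" using elem_in_fractions[of "unit_vec (gk_deg n) 1"] by simp
qed

lemma fraction_series_unique:
  assumes c: "c \<in> carrier_vec (gk_deg n)" "d \<noteq> 0" and c': "c' \<in> carrier_vec (gk_deg n)" "d' \<noteq> 0"
    and eq: "elem c / eval_x d = elem c' / eval_x d'"
  shows "series c / poly_series d = series c' / poly_series d'"
proof -
  let ?v = "d' \<cdot>\<^sub>v c - d \<cdot>\<^sub>v c'"
  have v: "?v \<in> carrier_vec (gk_deg n)" using c c' by simp
  have "elem ?v = 0"
    using c c' eq eval_x_nonzero[of d] eval_x_nonzero[of d']
    by (simp add: gk_eval_diff[OF eval_x_hom] gk_eval_smult[OF eval_x_hom] field_simps)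
  then have "?v = 0\<^sub>v (gk_deg n)" using elem_nonzero[OF v] by blast
  then have "series ?v = 0" by (simp add: gk_eval_zero[OF fls_poly_X_pow_hom])
  then show ?thesis
    using c c' poly_series_nonzero[of d] poly_series_nonzero[of d']
    by (simp add: gk_eval_diff[OF fls_poly_X_pow_hom] gk_eval_smult[OF fls_poly_X_pow_hom] field_simps)
qed

text \<open>Well defined by \<open>fraction_series_unique\<close>, as every element is a fraction (\<open>fractions_UNIV\<close>).\<close>
definition laurent :: "'L \<Rightarrow> 'k fls" where
  "laurent a = (SOME s. \<exists>c d. c \<in> carrier_vec (gk_deg n) \<and> d \<noteq> 0 \<and> a = elem c / eval_x d
                 \<and> s = series c / poly_series d)"

lemma laurent_fraction:
  assumes "c \<in> carrier_vec (gk_deg n)" "d \<noteq> 0"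
  shows "laurent (elem c / eval_x d) = series c / poly_series d"
proof -
  let ?P = "\<lambda>s. \<exists>c' d'. c' \<in> carrier_vec (gk_deg n) \<and> d' \<noteq> 0 \<and> elem c / eval_x d = elem c' / eval_x d'
                 \<and> s = series c' / poly_series d'"
  have "?P (laurent (elem c / eval_x d))"
    unfolding laurent_def by (rule someI[of ?P "series c / poly_series d"]) (use assms in blast)
  then show ?thesis using fraction_series_unique[OF assms] by auto
qed

lemma laurent_elem: "c \<in> carrier_vec (gk_deg n) \<Longrightarrow> laurent (elem c) = series c"
  using laurent_fraction[of c 1] by simp

lemma laurent_add: "laurent (a + b) = laurent a + laurent b"
proof -
  obtain c d c' d' where cd: "c \<in> carrier_vec (gk_deg n)" "d \<noteq> 0" "eval_x d \<noteq> 0" "a = elem c / eval_x d"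
    and cd': "c' \<in> carrier_vec (gk_deg n)" "d' \<noteq> 0" "eval_x d' \<noteq> 0" "b = elem c' / eval_x d'"
    using fractions_UNIV by (metis UNIV_I fractionsE)
  have "a + b = elem (d' \<cdot>\<^sub>v c + d \<cdot>\<^sub>v c') / eval_x (d * d')"
    unfolding cd(4) cd'(4) using cd cd' by (simp add: gk_eval_add[OF eval_x_hom] gk_eval_smult[OF eval_x_hom] L.hom_mult field_simps)
  then have "laurent (a + b) = series (d' \<cdot>\<^sub>v c + d \<cdot>\<^sub>v c') / poly_series (d * d')"
    using cd cd' by (simp add: laurent_fraction)
  also have "\<dots> = series c / poly_series d + series c' / poly_series d'"
    using cd cd' poly_series_nonzero[of d] poly_series_nonzero[of d']
    by (simp add: gk_eval_add[OF fls_poly_X_pow_hom] gk_eval_smult[OF fls_poly_X_pow_hom] F.hom_mult field_simps)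
  finally show ?thesis using cd cd' by (simp add: laurent_fraction)
qed

lemma laurent_mult: "laurent (a * b) = laurent a * laurent b"
proof -
  obtain c d c' d' where cd: "c \<in> carrier_vec (gk_deg n)" "d \<noteq> 0" "a = elem c / eval_x d"
    and cd': "c' \<in> carrier_vec (gk_deg n)" "d' \<noteq> 0" "b = elem c' / eval_x d'"
    using fractions_UNIV by (metis UNIV_I fractionsE)
  have "a * b = elem (mult_mat n c *\<^sub>v c') / eval_x (d * d')"
    unfolding cd(3) cd'(3) using cd cd' by (simp add: gk_eval_mult[OF eval_x_hom y_power z_power, symmetric] L.hom_mult)
  then have "laurent (a * b) = series (mult_mat n c *\<^sub>v c') / poly_series (d * d')"
    using cd cd' mult_mat_carrier[of n c] by (simp add: laurent_fraction)
  also have "\<dots> = (series c / poly_series d) * (series c' / poly_series d')"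
    using cd' by (simp add: gk_eval_mult[OF fls_poly_X_pow_hom gk_Y_power gk_Z_power, symmetric] F.hom_mult)
  finally show ?thesis using cd cd' by (simp add: laurent_fraction)
qed

lemma laurent_one: "laurent 1 = 1"
  using laurent_elem[of "unit_vec (gk_deg n) 0"]
  by (simp add: gk_eval_unit_vec[OF eval_x_hom gk_deg_pos] gk_eval_unit_vec[OF fls_poly_X_pow_hom gk_deg_pos] gk_monomial_0)

lemma laurent_zero: "laurent 0 = 0"
  using laurent_add[of 0 0] by (metis add.right_neutral add_left_cancel)

sublocale laurent: field_hom laurent
  by unfold_locales (simp_all add: laurent_add laurent_mult laurent_one laurent_zero)

lemma laurent_const: "laurent (e a) = fls_const a"
proof -
  have "laurent (e a) = poly_series [:a:]"
    using laurent_elem[of "[:a:] \<cdot>\<^sub>v unit_vec (gk_deg n) 0"]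
    by (simp add: gk_eval_const[OF eval_x_hom] gk_eval_const[OF fls_poly_X_pow_hom] eval_x_const)
  then show ?thesis unfolding fls_poly_X_pow_def fps_poly_X_pow_def by (cases "a = 0") (auto simp: map_poly_pCons)
qed

lemma laurent_x: "laurent x = fls_X ^ gk_deg n"
proof -
  have "laurent x = poly_series [:0,1:]"
    using laurent_elem[of "[:0,1:] \<cdot>\<^sub>v unit_vec (gk_deg n) 0"]
    by (simp add: gk_eval_const[OF eval_x_hom] gk_eval_const[OF fls_poly_X_pow_hom] eval_x_X)
  then show ?thesis unfolding fls_poly_X_pow_def fps_poly_X_pow_def by (simp add: map_poly_pCons fps_to_fls_power)
qed

lemma laurent_y: "laurent y = gk_Y n"
  using laurent_elem[of "unit_vec (gk_deg n) (gk_m n)"] n_ge_2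
  by (simp add: gk_eval_y[OF eval_x_hom] gk_eval_y[OF fls_poly_X_pow_hom])

lemma laurent_z: "laurent z = gk_Z n"
proof -
  have "elem (unit_vec (gk_deg n) 1) = z" "series (unit_vec (gk_deg n) 1) = gk_Z n"
    by (rule gk_eval_z[OF eval_x_hom n_ge_2], rule gk_eval_z[OF fls_poly_X_pow_hom n_ge_2])
  then show ?thesis using laurent_elem[of "unit_vec (gk_deg n) 1"] by simp
qed

lemma x_y_z_nonzero: "x \<noteq> 0" "y \<noteq> 0" "z \<noteq> 0"
  using laurent.hom_0_iff[of x] laurent.hom_0_iff[of y] laurent.hom_0_iff[of z]
    laurent_x laurent_y laurent_z gk_Y_nonzero gk_Z_nonzero by simp_all

definition val0 :: "'L \<Rightarrow> int" where "val0 a = fls_subdegree (laurent a)"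

lemma is_place_val0: "is_place e val0"
  unfolding is_place_def
proof (intro conjI allI impI)
  fix a b :: 'L assume "a \<noteq> 0" "b \<noteq> 0"
  then show "val0 (a * b) = val0 a + val0 b"
    unfolding val0_def by (simp add: laurent.hom_mult)
  assume "a + b \<noteq> 0"
  then have "laurent a + laurent b \<noteq> 0" by (simp flip: laurent.hom_add)
  then show "min (val0 a) (val0 b) \<le> val0 (a + b)"
    unfolding val0_def using fls_plus_subdegree[of "laurent a" "laurent b"] by (simp add: laurent.hom_add)
next
  fix c :: 'k
  show "val0 (e c) = 0" unfolding val0_def laurent_const by simp
next
  have "z \<noteq> 0" by (rule x_y_z_nonzero(3))
  moreover have "val0 z = 1" unfolding val0_def laurent_z by (rule gk_Z_subdegree)
  ultimately show "\<exists>t. t \<noteq> 0 \<and> val0 t = 1" by blast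
qed

lemma val0_monomial_quotient:
  "val0 (y ^ i * z ^ j / x ^ k) = int i * int (gk_m n) + int j - int k * int (gk_deg n)"
proof -
  let ?f = "y ^ i * z ^ j / x ^ k"
  have "?f * x ^ k = y ^ i * z ^ j" using x_y_z_nonzero by simp
  then have "laurent ?f * laurent (x ^ k) = laurent (y ^ i) * laurent (z ^ j)" by (metis laurent.hom_mult)
  then have "laurent ?f * (fls_X ^ gk_deg n) ^ k = gk_Y n ^ i * gk_Z n ^ j"
    by (simp only: laurent.hom_power laurent_x laurent_y laurent_z)
  then have "fls_subdegree (laurent ?f * (fls_X ^ gk_deg n) ^ k) = fls_subdegree (gk_Y n ^ i * (gk_Z n :: 'k fls) ^ j)"
    by simp
  moreover have "laurent ?f \<noteq> 0" using x_y_z_nonzero by simp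
  ultimately have "val0 ?f + int k * int (gk_deg n) = int i * int (gk_m n) + int j"
    unfolding val0_def using gk_Y_nonzero gk_Z_nonzero gk_Y_subdegree gk_Z_subdegree
    by (simp add: fls_subdegree_pow)
  then show ?thesis by simp
qed

end

section \<open>Distinct pole divisors\<close>

lemma mixed_radix_unique:
  fixes i j k i' j' k' n m :: nat
  assumes m: "0 < m" and i: "i \<le> n" "i' \<le> n" and j: "j < m" "j' < m"
    and eq: "int k * int ((n+1)*m) - int i * int m - int j = int k' * int ((n+1)*m) - int i' * int m - int j'"
  shows "i = i' \<and> j = j' \<and> k = k'"
proof -
  define t where "t = (int k - int k') * (int n + 1) - (int i - int i')"
  have jt: "int j - int j' = int m * t" using eq unfolding t_def by (simp add: algebra_simps)
  have "t = 0"
  proof (rule ccontr)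
    assume "t \<noteq> 0"
    then have "\<bar>t\<bar> \<ge> 1" by simp
    then have "\<bar>int m * t\<bar> \<ge> int m" using m by (simp add: abs_mult)
    moreover have "\<bar>int j - int j'\<bar> < int m" using j by simp
    ultimately show False using jt by simp
  qed
  then have jj: "j = j'" using jt by simp
  have ki: "(int k - int k') * (int n + 1) = int i - int i'" using \<open>t = 0\<close> unfolding t_def by simp
  have "k = k'"
  proof (rule ccontr)
    assume "k \<noteq> k'"
    then have "\<bar>int k - int k'\<bar> \<ge> 1" by simp
    then have "\<bar>(int k - int k') * (int n + 1)\<bar> \<ge> int n + 1" by (simp add: abs_mult)
    moreover have "\<bar>int i - int i'\<bar> \<le> int n" using i by simp
    ultimately show False using ki by simp
  qed
  then show ?thesis using ki jj by simp
qed

lemma mixed_radix_pos: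
  fixes i j k n m :: nat
  assumes "i \<le> n" "j < m" "1 \<le> k"
  shows "int k * int ((n+1)*m) - int i * int m - int j > 0"
proof -
  have "int ((n+1)*m) \<le> int k * int ((n+1)*m)"
    using mult_right_mono[of 1 "int k" "int ((n+1)*m)"] assms(3) by simp
  moreover have "int i * int m \<le> int n * int m" using assms(1) by (simp add: mult_right_mono)
  moreover have "int ((n+1)*m) = int n * int m + int m" by (simp add: algebra_simps)
  ultimately show ?thesis using assms(2) by linarith
qed

lemma T_idx_bounds: "(i, j) \<in> T_idx n k \<Longrightarrow> i \<le> n \<and> j \<le> n^2 - n"
  unfolding T_idx_def by (auto split: if_splits)

context gk_field
begin

lemma pole_order_P0:
  "pole_divisor e (y ^ i * z ^ j / x ^ k) val0 = nat (int k * int ((n+1) * gk_m n) - int i * int (gk_m n) - int j)"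
  unfolding pole_divisor_def using is_place_val0 by (simp add: val0_monomial_quotient gk_deg_def algebra_simps)

lemma pole_divisor_T_set_inj:
  assumes "1 \<le> k" "1 \<le> k'" and "f \<in> T_set n x y z k" "f' \<in> T_set n x y z k'"
    and "pole_divisor e f = pole_divisor e f'"
  shows "f = f'"
proof -
  obtain i j where f: "(i, j) \<in> T_idx n k" "f = y ^ i * z ^ j / x ^ k"
    using assms(3) unfolding T_set_def by auto
  obtain i' j' where f': "(i', j') \<in> T_idx n k'" "f' = y ^ i' * z ^ j' / x ^ k'"
    using assms(4) unfolding T_set_def by auto
  have ij: "i \<le> n" "j < gk_m n" and ij': "i' \<le> n" "j' < gk_m n"
    using T_idx_bounds[OF f(1)] T_idx_bounds[OF f'(1)] unfolding gk_m_def by auto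
  have "pole_divisor e f val0 = pole_divisor e f' val0" using assms(5) by simp
  then have "nat (int k * int ((n+1) * gk_m n) - int i * int (gk_m n) - int j)
      = nat (int k' * int ((n+1) * gk_m n) - int i' * int (gk_m n) - int j')"
    unfolding f(2) f'(2) pole_order_P0 .
  then have "int k * int ((n+1) * gk_m n) - int i * int (gk_m n) - int j
      = int k' * int ((n+1) * gk_m n) - int i' * int (gk_m n) - int j'"
    using mixed_radix_pos[OF ij assms(1)] mixed_radix_pos[OF ij' assms(2)] by simp
  then have "i = i' \<and> j = j' \<and> k = k'" using mixed_radix_unique[OF gk_m_pos ij(1) ij'(1) ij(2) ij'(2)] by blast
  then show ?thesis using f f' by simp
qed

end

lemma of_nat_eq_0_if_card_prime_power:
  assumes "prime p" and "1 \<le> t" and "card (UNIV :: 'k::{field,finite} set) = p ^ s"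
  shows "(of_nat (p ^ t) :: 'k) = 0"
proof -
  have "prime CHAR('k)" by (intro prime_CHAR_semidom finite_imp_CHAR_pos) simp
  moreover have "CHAR('k) dvd p ^ s" using CHAR_dvd_CARD[where 'a='k] assms(3) by simp
  ultimately have "CHAR('k) = p" using assms(1) prime_dvd_power primes_dvd_imp_eq by blast
  then have "(of_nat p :: 'k) = 0" by (metis of_nat_CHAR)
  then show ?thesis using assms(2) by (simp add: of_nat_power power_0_left)
qed

lemma gk_char_if_of_nat_eq_0:
  assumes "2 \<le> n" and "(of_nat n :: 'k::field) = 0"
  shows "gk_char TYPE('k) n"
proof unfold_locales
  have m: "gk_m n = n * (n - 1) + 1" unfolding gk_m_def by (simp add: power2_eq_square algebra_simps)
  show "2 \<le> n" by (rule assms(1))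
  show "(of_nat (n+1) :: 'k) \<noteq> 0" "(of_nat (gk_m n) :: 'k) \<noteq> 0"
    using assms(2) unfolding m by simp_all
  show "odd (gk_m n)" unfolding m by (cases "even n") auto
qed

theorem mainTheorem2:
  fixes n :: nat and e :: "'k::{field,finite} \<Rightarrow> 'L::field" and x y z :: 'L
  assumes "\<exists>p m. prime p \<and> 1 \<le> m \<and> n = p ^ m"
    and "3 \<le> n"
    and "card (UNIV :: 'k set) = (n ^ 3) ^ 2"
    and "GK_function_field n e x y z"
    and "1 \<le> k" and "k \<le> n^2 - 1" and "1 \<le> k'" and "k' \<le> n^2 - 1"
    and "f \<in> T_set n x y z k" and "f' \<in> T_set n x y z k'"
    and "f \<noteq> f'"
  shows "pole_divisor e f \<noteq> pole_divisor e f'"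
proof -
  from assms(1) obtain p t where p: "prime p" "1 \<le> t" "n = p ^ t" by blast
  have "(n ^ 3) ^ 2 = p ^ (t * 3 * 2)" unfolding p(3) by (simp only: power_mult[symmetric] mult.commute)
  then have card: "card (UNIV :: 'k set) = p ^ (t * 3 * 2)" using assms(3) by simp
  have char: "(of_nat n :: 'k) = 0" using of_nat_eq_0_if_card_prime_power[OF p(1,2) card] p(3) by simp
  interpret gk_char n "TYPE('k)" by (rule gk_char_if_of_nat_eq_0[OF _ char]) (use assms(2) in simp)
  interpret gk_field n "TYPE('k)" e x y z
    using assms(4) unfolding GK_function_field_def by unfold_locales auto
  show ?thesis using pole_divisor_T_set_inj assms(5,7,9-11) by blast
qed

end
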